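(* Let $G$ be a connected graph. Then there is a homeomorphism $\mathrm{Ult}(\mathfrak{T}(G)) \to \Theta(G)$ from the ultrafilter space of the separation algebra $\mathfrak{T}(G)$ of $G$ onto the tangle space $\Theta(G)$ of $G$.
   Context: Graphs are simple and undirected, possibly infinite; $V(G)$, $E(G)$ are the vertex and edge sets, and for $E\subset E(G)$, $V(E)$ is the set of vertices incident with some edge of $E$. Ultrafilter space. For a Boolean algebra $\mathfrak B$ (the one-element algebra is allowed), a filter is a nonempty upward closed subset closed under $\wedge$ and not containing $0$; an ultrafilter is a maximal filter. $\mathrm{Ult}(\mathfrak B)$ is the set of ultrafilters with the topology whose basic open sets are $[B]=\{u : B\in u\}$, $B\in\mathfrak B$ (empty if $0=1$). Separation algebra. Let $\mathfrak t(G)=\{E\subset E(G) : V(E)\cap V(E(G)\setminus E)\text{ is finite}\}$, a Boolean subalgebra of $2^{E(G)}$, and let $F_G\subset\mathfrak t(G)$ be the ideal of finite sets of edges. The separation algebra is $\mathfrak T(G)=\mathfrak t(G)/F_G$ (two elements are identified when their symmetric difference is finite). Tangles. A separation of $G$ is $\{A,B\}$ with $A,B\subset V(G)$, $A\cup B=V(G)$, such that every edge of $G$ lies in $G[A]$ or in $G[B]$; its order is $|A\cap B|$. An orientation of $\{A,B\}$ is one of the ordered pairs $(A,B)$, $(B,A)$. An $\aleph_0$-orientation $\tau$ is a set containing exactly one orientation of each separation of finite order (and nothing else). Oriented separations $(A_1,B_1),\dots,(A_n,B_n)$ form a contradiction of order $n$ if $G[A_1]\cup\dots\cup G[A_n]=G$.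 An ($\aleph_0$-)tangle of $G$ is an $\aleph_0$-orientation with no contradictions of order $1$, $2$ or $3$ among its elements. $\Theta(G)$ is the set of all $\aleph_0$-tangles of $G$. Topology on $\Theta(G)$. For finite $F\subset V(G)$ let $\mathcal S_F$ be the set of vertex sets of the connected components of $G\setminus F$. The topology of $\Theta(G)$ is the one generated by the subbasis consisting of the sets $\{\tau\in\Theta(G) : (F\cup\bigcup(\mathcal S_F\setminus\mathcal A),\ F\cup\bigcup\mathcal A)\in\tau\}$, with $F\subset V(G)$ finite and $\mathcal A\subset\mathcal S_F$. (This is the inverse limit topology obtained by identifying $\tau$ with the compatible family of ultrafilters $x_\tau(F)=\{\mathcal A\subset\mathcal S_F : (F\cup\bigcup(\mathcal S_F\setminus\mathcal A),F\cup\bigcup\mathcal A)\in\tau\}$ in $\varprojlim_F\mathrm{Ult}(2^{\mathcal S_F})$.) *)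

theory Defs
  imports "HOL-Analysis.Analysis" "HOL-Algebra.Lattice"
begin

section \<open>Graphs\<close>

record 'v graph =
  verts :: "'v set"
  edges :: "'v set set"

definition simple_graph :: "'v graph \<Rightarrow> bool" where
  "simple_graph G \<longleftrightarrow> (\<forall>e\<in>edges G. e \<subseteq> verts G \<and> card e = 2)"

definition induced :: "'v graph \<Rightarrow> 'v set \<Rightarrow> 'v graph" where
  "induced G A = \<lparr>verts = verts G \<inter> A, edges = {e \<in> edges G. e \<subseteq> A}\<rparr>"

definition graph_Union :: "'v graph set \<Rightarrow> 'v graph" where
  "graph_Union Gs = \<lparr>verts = (\<Union>H\<in>Gs. verts H), edges = (\<Union>H\<in>Gs. edges H)\<rparr>"

definition reach :: "'v graph \<Rightarrow> ('v \<times> 'v) set" where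
  "reach G = {(u, v). {u, v} \<in> edges G}\<^sup>* \<inter> (verts G \<times> verts G)"

text \<open>The empty graph counts as connected.\<close>

definition connected_graph :: "'v graph \<Rightarrow> bool" where
  "connected_graph G \<longleftrightarrow> (\<forall>u\<in>verts G. \<forall>v\<in>verts G. (u, v) \<in> reach G)"

text \<open>The vertex sets of the connected components, as classes of the reachability relation.\<close>

definition components_verts :: "'v graph \<Rightarrow> 'v set set" where
  "components_verts G = verts G // reach G"

definition comps_minus :: "'v graph \<Rightarrow> 'v set \<Rightarrow> 'v set set" where
  "comps_minus G F = components_verts (induced G (verts G - F))"


section \<open>Boolean algebras with a carrier and their ultrafilter spaces\<close>

text \<open>
  A Boolean algebra is presented as a bounded, distributive, complemented lattice;
  the one-element lattice is allowed.
\<close>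

locale boolean_lattice = bounded_lattice +
  assumes meet_join_distrib:
    "\<lbrakk>x \<in> carrier L; y \<in> carrier L; z \<in> carrier L\<rbrakk> \<Longrightarrow>
       x \<sqinter> (y \<squnion> z) = (x \<sqinter> y) \<squnion> (x \<sqinter> z)"
  and complement_exists:
    "x \<in> carrier L \<Longrightarrow> \<exists>y\<in>carrier L. x \<sqinter> y = \<bottom> \<and> x \<squnion> y = \<top>"

definition ba_filter :: "('b, 'm) gorder_scheme \<Rightarrow> 'b set \<Rightarrow> bool" where
  "ba_filter L u \<longleftrightarrow> u \<subseteq> carrier L \<and> u \<noteq> {} \<and>
     (\<forall>x\<in>u. \<forall>y\<in>carrier L. x \<sqsubseteq>\<^bsub>L\<^esub> y \<longrightarrow> y \<in> u) \<and>
     (\<forall>x\<in>u. \<forall>y\<in>u. x \<sqinter>\<^bsub>L\<^esub> y \<in> u) \<and>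
     \<bottom>\<^bsub>L\<^esub> \<notin> u"

definition Ult :: "('b, 'm) gorder_scheme \<Rightarrow> 'b set set" where
  "Ult L = {u. ba_filter L u \<and> (\<forall>w. ba_filter L w \<and> u \<subseteq> w \<longrightarrow> w = u)}"

definition ult_topology :: "('b, 'm) gorder_scheme \<Rightarrow> 'b set topology" where
  "ult_topology L = topology_generated_by {{u \<in> Ult L. b \<in> u} | b. b \<in> carrier L}"

lemma topspace_ult_topology [simp]: "topspace (ult_topology L) = Ult L"
proof -
  have "\<exists>b. b \<in> carrier L \<and> b \<in> u" if "u \<in> Ult L" for u
  proof -
    have "u \<subseteq> carrier L" "u \<noteq> {}"
      using that by (simp_all add: Ult_def ba_filter_def)
    then show ?thesis by (meson equals0I subsetD)
  qed
  then have "\<Union>((\<lambda>b. {u \<in> Ult L. b \<in> u}) ` carrier L) = Ult L"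
    by auto
  then show ?thesis
    by (simp add: ult_topology_def Setcompr_eq_image)
qed


section \<open>The separation algebra\<close>

definition sep_sets :: "'v graph \<Rightarrow> 'v set set set" where
  "sep_sets G = {E. E \<subseteq> edges G \<and> finite (\<Union>E \<inter> \<Union>(edges G - E))}"

definition fin_ideal :: "'v graph \<Rightarrow> 'v set set set" where
  "fin_ideal G = {E. E \<subseteq> edges G \<and> finite E}"

definition sep_rel :: "'v graph \<Rightarrow> ('v set set \<times> 'v set set) set" where
  "sep_rel G = {(A, B). A \<in> sep_sets G \<and> B \<in> sep_sets G \<and> (A - B) \<union> (B - A) \<in> fin_ideal G}"

text \<open>
  The quotient algebra, given by its order: \<open>X \<sqsubseteq> Y\<close> iff there are representatives with
  \<open>A \<subseteq> B\<close>.  The lemmas below show that this is a Boolean algebra whose operations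
  are those induced by the set operations on representatives.
\<close>

definition sep_algebra :: "'v graph \<Rightarrow> 'v set set set gorder" where
  "sep_algebra G =
     \<lparr>carrier = sep_sets G // sep_rel G, eq = (=),
      le = (\<lambda>X Y. \<exists>A\<in>X. \<exists>B\<in>Y. A \<subseteq> B)\<rparr>"

abbreviation sep_class :: "'v graph \<Rightarrow> 'v set set \<Rightarrow> 'v set set set" where
  "sep_class G A \<equiv> sep_rel G `` {A}"

lemma sep_sets_Int:
  assumes "A \<in> sep_sets G" "B \<in> sep_sets G"
  shows "A \<inter> B \<in> sep_sets G"
proof -
  have "\<Union>(A \<inter> B) \<inter> \<Union>(edges G - A \<inter> B)
      \<subseteq> (\<Union>A \<inter> \<Union>(edges G - A)) \<union> (\<Union>B \<inter> \<Union>(edges G - B))"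
    by blast
  moreover have "finite ((\<Union>A \<inter> \<Union>(edges G - A)) \<union> (\<Union>B \<inter> \<Union>(edges G - B)))"
    using assms by (simp add: sep_sets_def)
  ultimately have "finite (\<Union>(A \<inter> B) \<inter> \<Union>(edges G - A \<inter> B))"
    by (rule finite_subset)
  moreover have "A \<inter> B \<subseteq> edges G" using assms by (auto simp: sep_sets_def)
  ultimately show ?thesis by (simp add: sep_sets_def)
qed

lemma sep_sets_Compl:
  assumes "A \<in> sep_sets G"
  shows "edges G - A \<in> sep_sets G"
  using assms by (auto simp: sep_sets_def double_diff Int_commute)

lemma sep_sets_Un:
  assumes "A \<in> sep_sets G" "B \<in> sep_sets G"
  shows "A \<union> B \<in> sep_sets G"
proof -
  have "A \<union> B = edges G - ((edges G - A) \<inter> (edges G - B))"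
    using assms by (auto simp: sep_sets_def)
  then show ?thesis
    using assms by (metis sep_sets_Compl sep_sets_Int)
qed

lemma sep_sets_empty: "{} \<in> sep_sets G" and sep_sets_edges: "edges G \<in> sep_sets G"
  by (auto simp: sep_sets_def)

lemma fin_ideal_subset:
  assumes "simple_graph G"
  shows "fin_ideal G \<subseteq> sep_sets G"
proof
  fix E assume E: "E \<in> fin_ideal G"
  have "finite e" if "e \<in> E" for e
    using assms E that by (intro card_ge_0_finite) (auto simp: simple_graph_def fin_ideal_def)
  then show "E \<in> sep_sets G"
    using E by (auto simp: sep_sets_def fin_ideal_def)
qed

lemma sep_rel_iff:
  "(A, B) \<in> sep_rel G \<longleftrightarrow>
     A \<in> sep_sets G \<and> B \<in> sep_sets G \<and> finite (A - B) \<and> finite (B - A)"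
  by (auto simp: sep_rel_def sep_sets_def fin_ideal_def)

lemma finite_Diff_trans: "finite (A - B) \<Longrightarrow> finite (B - C) \<Longrightarrow> finite (A - C)"
  by (rule finite_subset[of _ "(A - B) \<union> (B - C)"]) auto

lemma equiv_sep_rel: "equiv (sep_sets G) (sep_rel G)"
proof (rule equivI)
  show "sep_rel G \<subseteq> sep_sets G \<times> sep_sets G" by (auto simp: sep_rel_iff)
  show "refl_on (sep_sets G) (sep_rel G)" by (auto simp: refl_on_def sep_rel_iff)
  show "sym (sep_rel G)" by (auto simp: sym_def sep_rel_iff)
  show "trans (sep_rel G)"
  proof (rule transI)
    fix A B C assume "(A, B) \<in> sep_rel G" "(B, C) \<in> sep_rel G"
    then show "(A, C) \<in> sep_rel G"
      using finite_Diff_trans[of A B C] finite_Diff_trans[of C B A] by (simp add: sep_rel_iff)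
  qed
qed

lemma sep_class_eq_iff:
  assumes "A \<in> sep_sets G" "B \<in> sep_sets G"
  shows "sep_class G A = sep_class G B \<longleftrightarrow> finite (A - B) \<and> finite (B - A)"
  using assms eq_equiv_class_iff[OF equiv_sep_rel assms] by (simp add: sep_rel_iff)

lemma sep_class_carrier: "A \<in> sep_sets G \<Longrightarrow> sep_class G A \<in> carrier (sep_algebra G)"
  by (simp add: sep_algebra_def quotientI)

lemma sep_carrierE:
  assumes "X \<in> carrier (sep_algebra G)"
  obtains A where "A \<in> sep_sets G" "X = sep_class G A"
  using assms by (auto simp: sep_algebra_def elim: quotientE)

lemma sep_le_iff:
  assumes A: "A \<in> sep_sets G" and B: "B \<in> sep_sets G"
  shows "sep_class G A \<sqsubseteq>\<^bsub>sep_algebra G\<^esub> sep_class G B \<longleftrightarrow> finite (A - B)"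
proof
  assume "sep_class G A \<sqsubseteq>\<^bsub>sep_algebra G\<^esub> sep_class G B"
  then obtain A' B' where "finite (A - A')" "finite (B' - B)" "A' \<subseteq> B'"
    by (auto simp: sep_algebra_def sep_rel_iff)
  moreover have "A - B \<subseteq> (A - A') \<union> (B' - B)" using \<open>A' \<subseteq> B'\<close> by auto
  ultimately show "finite (A - B)" by (meson finite_UnI finite_subset)
next
  assume fin: "finite (A - B)"
  have "A - A \<inter> B = A - B" "A \<inter> B - A = {}" by blast+
  then have "A \<inter> B \<in> sep_class G A" "B \<in> sep_class G B"
    unfolding Image_singleton_iff sep_rel_iff using fin A B sep_sets_Int[OF A B]
    by (simp_all only: Diff_cancel finite.emptyI simp_thms)
  then show "sep_class G A \<sqsubseteq>\<^bsub>sep_algebra G\<^esub> sep_class G B"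
    unfolding sep_algebra_def by (simp del: Image_singleton_iff) (meson Int_lower2)
qed

lemma sep_algebra_partial_order: "partial_order (sep_algebra G)"
proof
  show "(.=\<^bsub>sep_algebra G\<^esub>) = (=)" by (simp add: sep_algebra_def)
  show "X \<sqsubseteq>\<^bsub>sep_algebra G\<^esub> X" if "X \<in> carrier (sep_algebra G)" for X
    using that by (elim sep_carrierE) (simp add: sep_le_iff)
  show "X .=\<^bsub>sep_algebra G\<^esub> Y"
    if "X \<sqsubseteq>\<^bsub>sep_algebra G\<^esub> Y" "Y \<sqsubseteq>\<^bsub>sep_algebra G\<^esub> X"
      "X \<in> carrier (sep_algebra G)" "Y \<in> carrier (sep_algebra G)" for X Y
  proof -
    have "X = Y"
      using that by (elim sep_carrierE) (simp add: sep_le_iff sep_class_eq_iff)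
    then show ?thesis by (simp add: sep_algebra_def)
  qed
  show "X \<sqsubseteq>\<^bsub>sep_algebra G\<^esub> Z"
    if "X \<sqsubseteq>\<^bsub>sep_algebra G\<^esub> Y" "Y \<sqsubseteq>\<^bsub>sep_algebra G\<^esub> Z"
      "X \<in> carrier (sep_algebra G)" "Y \<in> carrier (sep_algebra G)"
      "Z \<in> carrier (sep_algebra G)" for X Y Z
    using that by (elim sep_carrierE) (auto simp: sep_le_iff intro: finite_Diff_trans)
qed (auto simp: sep_algebra_def)

lemma sep_inf_greatest:
  assumes A: "A \<in> sep_sets G" and B: "B \<in> sep_sets G"
  shows "greatest (sep_algebra G) (sep_class G (A \<inter> B))
           (Lower (sep_algebra G) {sep_class G A, sep_class G B})"
proof -
  have "finite (A \<inter> B - A)" "finite (A \<inter> B - B)"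
    by (rule finite_subset[of _ "{}"]; blast)+
  moreover have "Z \<sqsubseteq>\<^bsub>sep_algebra G\<^esub> sep_class G (A \<inter> B)"
    if "Z \<in> carrier (sep_algebra G)" "Z \<sqsubseteq>\<^bsub>sep_algebra G\<^esub> sep_class G A"
      "Z \<sqsubseteq>\<^bsub>sep_algebra G\<^esub> sep_class G B" for Z
    using that A B by (elim sep_carrierE) (simp add: sep_le_iff sep_sets_Int Diff_Int)
  ultimately show ?thesis
    using A B by (simp add: greatest_def Lower_def sep_class_carrier sep_sets_Int sep_le_iff)
qed

lemma sep_sup_least:
  assumes A: "A \<in> sep_sets G" and B: "B \<in> sep_sets G"
  shows "least (sep_algebra G) (sep_class G (A \<union> B))
           (Upper (sep_algebra G) {sep_class G A, sep_class G B})"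
proof -
  have "finite (A - (A \<union> B))" "finite (B - (A \<union> B))"
    by (rule finite_subset[of _ "{}"]; blast)+
  moreover have "sep_class G (A \<union> B) \<sqsubseteq>\<^bsub>sep_algebra G\<^esub> Z"
    if "Z \<in> carrier (sep_algebra G)" "sep_class G A \<sqsubseteq>\<^bsub>sep_algebra G\<^esub> Z"
      "sep_class G B \<sqsubseteq>\<^bsub>sep_algebra G\<^esub> Z" for Z
    using that A B by (elim sep_carrierE) (simp add: sep_le_iff sep_sets_Un Un_Diff)
  ultimately show ?thesis
    using A B by (simp add: least_def Upper_def sep_class_carrier sep_sets_Un sep_le_iff)
qed

lemma sep_algebra_lattice: "lattice (sep_algebra G)"
proof -
  interpret partial_order "sep_algebra G" by (rule sep_algebra_partial_order)
  show ?thesis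
  proof
    fix X Y assume "X \<in> carrier (sep_algebra G)" "Y \<in> carrier (sep_algebra G)"
    then show "\<exists>s. least (sep_algebra G) s (Upper (sep_algebra G) {X, Y})"
      and "\<exists>s. greatest (sep_algebra G) s (Lower (sep_algebra G) {X, Y})"
      by (elim sep_carrierE, use sep_sup_least sep_inf_greatest in blast)+
  qed
qed

lemma sep_meet:
  assumes "A \<in> sep_sets G" "B \<in> sep_sets G"
  shows "sep_class G A \<sqinter>\<^bsub>sep_algebra G\<^esub> sep_class G B = sep_class G (A \<inter> B)"
proof -
  interpret lattice "sep_algebra G" by (rule sep_algebra_lattice)
  show ?thesis
    unfolding meet_def inf_def
    by (rule some_equality) (fact sep_inf_greatest[OF assms], erule greatest_unique[OF _ sep_inf_greatest[OF assms]])
qed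

lemma sep_join:
  assumes "A \<in> sep_sets G" "B \<in> sep_sets G"
  shows "sep_class G A \<squnion>\<^bsub>sep_algebra G\<^esub> sep_class G B = sep_class G (A \<union> B)"
proof -
  interpret lattice "sep_algebra G" by (rule sep_algebra_lattice)
  show ?thesis
    unfolding join_def sup_def
    by (rule some_equality) (fact sep_sup_least[OF assms], erule least_unique[OF _ sep_sup_least[OF assms]])
qed

lemma sep_bounded_lattice: "bounded_lattice (sep_algebra G)"
proof -
  interpret lattice "sep_algebra G" by (rule sep_algebra_lattice)
  have "finite (A - edges G)" if "A \<in> sep_sets G" for A
    by (rule finite_subset[of _ "{}"]) (use that in \<open>auto simp: sep_sets_def\<close>)
  then have "least (sep_algebra G) (sep_class G {}) (carrier (sep_algebra G))"
    and "greatest (sep_algebra G) (sep_class G (edges G)) (carrier (sep_algebra G))"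
    by (auto simp: least_def greatest_def sep_class_carrier sep_le_iff sep_sets_empty
        sep_sets_edges elim!: sep_carrierE)
  then show ?thesis
    by unfold_locales blast+
qed

lemma sep_bottom: "\<bottom>\<^bsub>sep_algebra G\<^esub> = sep_class G {}"
proof -
  interpret bounded_lattice "sep_algebra G" by (rule sep_bounded_lattice)
  show ?thesis
    by (rule bottom_eq[symmetric])
      (auto simp: sep_class_carrier sep_le_iff sep_sets_empty elim!: sep_carrierE)
qed

lemma sep_top: "\<top>\<^bsub>sep_algebra G\<^esub> = sep_class G (edges G)"
proof -
  interpret bounded_lattice "sep_algebra G" by (rule sep_bounded_lattice)
  have "finite (A - edges G)" if "A \<in> sep_sets G" for A
    by (rule finite_subset[of _ "{}"]) (use that in \<open>auto simp: sep_sets_def\<close>)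
  then show ?thesis
    by (intro top_eq[symmetric])
      (auto simp: sep_class_carrier sep_le_iff sep_sets_edges elim!: sep_carrierE)
qed

lemma boolean_lattice_sep_algebra: "boolean_lattice (sep_algebra G)"
proof -
  interpret bounded_lattice "sep_algebra G" by (rule sep_bounded_lattice)
  show ?thesis
  proof
    fix X Y Z
    assume "X \<in> carrier (sep_algebra G)" "Y \<in> carrier (sep_algebra G)"
      "Z \<in> carrier (sep_algebra G)"
    then show "X \<sqinter>\<^bsub>sep_algebra G\<^esub> (Y \<squnion>\<^bsub>sep_algebra G\<^esub> Z) =
      (X \<sqinter>\<^bsub>sep_algebra G\<^esub> Y) \<squnion>\<^bsub>sep_algebra G\<^esub> (X \<sqinter>\<^bsub>sep_algebra G\<^esub> Z)"
      by (elim sep_carrierE) (simp add: sep_meet sep_join sep_sets_Int sep_sets_Un Int_Un_distrib)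
  next
    fix X assume "X \<in> carrier (sep_algebra G)"
    then obtain A where A: "A \<in> sep_sets G" and X: "X = sep_class G A" by (rule sep_carrierE)
    let ?Y = "sep_class G (edges G - A)"
    have "A \<inter> (edges G - A) = {}" "A \<union> (edges G - A) = edges G"
      using A unfolding sep_sets_def by blast+
    then have "X \<sqinter>\<^bsub>sep_algebra G\<^esub> ?Y = \<bottom>\<^bsub>sep_algebra G\<^esub>"
      and "X \<squnion>\<^bsub>sep_algebra G\<^esub> ?Y = \<top>\<^bsub>sep_algebra G\<^esub>"
      unfolding X sep_meet[OF A sep_sets_Compl[OF A]] sep_join[OF A sep_sets_Compl[OF A]]
        sep_bottom sep_top by presburger+
    then show "\<exists>Y\<in>carrier (sep_algebra G). X \<sqinter>\<^bsub>sep_algebra G\<^esub> Y = \<bottom>\<^bsub>sep_algebra G\<^esub> \<and>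
        X \<squnion>\<^bsub>sep_algebra G\<^esub> Y = \<top>\<^bsub>sep_algebra G\<^esub>"
      using sep_class_carrier[OF sep_sets_Compl[OF A]] by blast
  qed
qed


section \<open>Tangles\<close>

text \<open>
  A separation \<open>{A, B}\<close> is represented by either of its orientations
  \<open>(A, B)\<close>, \<open>(B, A)\<close>; these coincide when \<open>A = B\<close>.
\<close>

definition is_separation :: "'v graph \<Rightarrow> 'v set \<Rightarrow> 'v set \<Rightarrow> bool" where
  "is_separation G A B \<longleftrightarrow> A \<subseteq> verts G \<and> B \<subseteq> verts G \<and> A \<union> B = verts G \<and>
     (\<forall>e\<in>edges G. e \<in> edges (induced G A) \<or> e \<in> edges (induced G B))"

definition fin_orientation :: "'v graph \<Rightarrow> ('v set \<times> 'v set) set \<Rightarrow> bool" where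
  "fin_orientation G \<tau> \<longleftrightarrow>
     (\<forall>(A, B)\<in>\<tau>. is_separation G A B \<and> finite (A \<inter> B)) \<and>
     (\<forall>A B. is_separation G A B \<and> finite (A \<inter> B) \<longrightarrow> (\<exists>!s. s \<in> \<tau> \<and> s \<in> {(A, B), (B, A)}))"

definition contradiction :: "'v graph \<Rightarrow> ('v set \<times> 'v set) list \<Rightarrow> bool" where
  "contradiction G ss \<longleftrightarrow> graph_Union ((\<lambda>(A, B). induced G A) ` set ss) = G"

definition tangles :: "'v graph \<Rightarrow> ('v set \<times> 'v set) set set" where
  "tangles G = {\<tau>. fin_orientation G \<tau> \<and>
     (\<nexists>ss. length ss \<in> {1, 2, 3} \<and> set ss \<subseteq> \<tau> \<and> contradiction G ss)}"

definition tangle_topology :: "'v graph \<Rightarrow> ('v set \<times> 'v set) set topology" where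
  "tangle_topology G = topology_generated_by
     {{\<tau> \<in> tangles G. (F \<union> \<Union>(comps_minus G F - \<A>), F \<union> \<Union>\<A>) \<in> \<tau>} | F \<A>.
        finite F \<and> F \<subseteq> verts G \<and> \<A> \<subseteq> comps_minus G F}"

lemma topspace_tangle_topology [simp]:
  assumes "simple_graph G"
  shows "topspace (tangle_topology G) = tangles G"
proof -
  have G: "induced G (verts G) = G"
    using assms by (intro graph.equality) (auto simp: induced_def simple_graph_def)
  have comps: "\<Union>(comps_minus G {}) = verts G"
    by (auto simp: comps_minus_def components_verts_def G quotient_def reach_def)
  have *: "({}, verts G) \<in> \<tau>" if \<tau>: "\<tau> \<in> tangles G" for \<tau>
  proof -
    have "is_separation G {} (verts G)"
      by (simp add: is_separation_def G)
    then have "({}, verts G) \<in> \<tau> \<or> (verts G, {}) \<in> \<tau>"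
      using \<tau> unfolding tangles_def fin_orientation_def by blast
    moreover have "contradiction G [(verts G, {})]"
      by (simp add: contradiction_def graph_Union_def G)
    then have "(verts G, {}) \<notin> \<tau>"
      using \<tau> unfolding tangles_def by force
    ultimately show ?thesis by blast
  qed
  let ?U = "{\<tau> \<in> tangles G. ({} \<union> \<Union>(comps_minus G {} - comps_minus G {}),
      {} \<union> \<Union>(comps_minus G {})) \<in> \<tau>}"
  let ?\<S> = "{{\<tau> \<in> tangles G. (F \<union> \<Union>(comps_minus G F - \<A>), F \<union> \<Union>\<A>) \<in> \<tau>} | F \<A>.
      finite F \<and> F \<subseteq> verts G \<and> \<A> \<subseteq> comps_minus G F}"
  have "tangles G = ?U"
    using * by (auto simp: comps)
  moreover have "?U \<in> ?\<S>"
    by (intro CollectI exI[of _ "{}"] exI[of _ "comps_minus G {}"] conjI refl) auto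
  ultimately have "tangles G \<subseteq> \<Union>?\<S>"
    by (metis (lifting) Union_upper)
  moreover have "\<Union>?\<S> \<subseteq> tangles G"
    by (intro Union_least) auto
  ultimately show ?thesis
    unfolding tangle_topology_def topology_generated_by_topspace by (rule equalityI[rotated])
qed

end

theory Submission
  imports Defs
begin

text \<open>
  An ultrafilter \<open>u\<close> orients a separation \<open>{A, B}\<close> of finite order towards the side whose
  induced edge set lies in \<open>u\<close>; a tangle \<open>\<tau>\<close> selects those \<open>E\<close> in \<open>\<tt>(G)\<close> with
  \<open>(V(E(G) - E), V(E)) \<in> \<tau>\<close>.  A tangle contains \<open>(X, V(G))\<close> for every finite \<open>X\<close>, so
  finitely many edges never matter, and avoiding contradictions of order at most 3 says that
  the discarded edge sets form a prime ideal.  Connectedness is only used to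
  exclude isolated vertices (a one-vertex graph has neither tangles nor ultrafilters), so that
  edge sets see all vertices.  Since the components of \<open>G - (A \<inter> B)\<close> lie on one side of
  \<open>{A, B}\<close>, the subbasis of the tangle space consists of the sets \<open>{\<tau>. (A, B) \<in> \<tau>}\<close> for all
  separations of finite order, and these correspond to the basic open sets of the ultrafilter
  space.
\<close>

section \<open>Ultrafilters of the separation algebra\<close>

(* sep_class abbreviates an image, which the simplifier would otherwise take apart *)
declare Image_singleton_iff [simp del]

lemma Ult_sep_upward:
  assumes "u \<in> Ult (sep_algebra G)" "sep_class G A \<in> u"
    "A \<in> sep_sets G" "B \<in> sep_sets G" "finite (A - B)"
  shows "sep_class G B \<in> u"
  using assms by (auto simp: Ult_def ba_filter_def sep_class_carrier sep_le_iff)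

lemma Ult_sep_Int:
  assumes "u \<in> Ult (sep_algebra G)" "sep_class G A \<in> u" "sep_class G B \<in> u"
    "A \<in> sep_sets G" "B \<in> sep_sets G"
  shows "sep_class G (A \<inter> B) \<in> u"
proof -
  have "sep_class G A \<sqinter>\<^bsub>sep_algebra G\<^esub> sep_class G B \<in> u"
    using assms(1-3) by (simp add: Ult_def ba_filter_def)
  then show ?thesis using sep_meet[OF assms(4,5)] by simp
qed

lemma Ult_sep_infinite:
  assumes "u \<in> Ult (sep_algebra G)" "sep_class G A \<in> u" "A \<in> sep_sets G"
  shows "infinite A"
proof
  assume "finite A"
  then have "sep_class G A = \<bottom>\<^bsub>sep_algebra G\<^esub>"
    using assms(3) by (simp add: sep_bottom sep_class_eq_iff sep_sets_empty)
  then show False using assms by (auto simp: Ult_def ba_filter_def)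
qed

text \<open>By maximality: if neither \<open>A\<close> nor its complement were in \<open>u\<close>,
  then \<open>u\<close> together with \<open>A\<close> would generate a strictly larger proper
  filter.\<close>

lemma Ult_sep_prime:
  assumes u: "u \<in> Ult (sep_algebra G)" and A: "A \<in> sep_sets G"
  shows "sep_class G A \<in> u \<or> sep_class G (edges G - A) \<in> u"
proof (rule ccontr)
  assume *: "\<not> ?thesis"
  \<comment> \<open>The filter generated by \<open>u\<close> and the class of \<open>A\<close>,
    written on representatives: \<open>C\<close> contains \<open>A \<inter> D\<close> up to finitely
    many edges.\<close>
  define w where "w = {sep_class G C | C. C \<in> sep_sets G \<and>
      (\<exists>D\<in>sep_sets G. sep_class G D \<in> u \<and> finite (A \<inter> D - C))}"
  \<comment> \<open>The condition is insensitive to finite changes of \<open>C\<close>, so it can be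
    tested on any representative.\<close>
  have w_iff: "sep_class G C \<in> w \<longleftrightarrow>
      (\<exists>D\<in>sep_sets G. sep_class G D \<in> u \<and> finite (A \<inter> D - C))" (is "_ \<longleftrightarrow> ?R C")
    if C: "C \<in> sep_sets G" for C
  proof
    assume "sep_class G C \<in> w"
    then obtain C' D where C': "sep_class G C = sep_class G C'" "C' \<in> sep_sets G"
      and D: "D \<in> sep_sets G" "sep_class G D \<in> u" "finite (A \<inter> D - C')"
      by (auto simp: w_def)
    have "finite (C' - C)" using C' C sep_class_eq_iff by blast
    then show "?R C" using D finite_Diff_trans by blast
  qed (use C in \<open>auto simp: w_def\<close>)
  have uf: "ba_filter (sep_algebra G) u" using u by (simp add: Ult_def)
  have sub: "u \<subseteq> w"
  proof
    fix x assume x: "x \<in> u"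
    then have "x \<in> carrier (sep_algebra G)" using uf by (auto simp: ba_filter_def)
    then obtain D where D: "D \<in> sep_sets G" "x = sep_class G D" by (rule sep_carrierE)
    have "finite (A \<inter> D - D)" by (rule finite_subset[of _ "{}"]) auto
    then show "x \<in> w" using D x w_iff by blast
  qed
  have carr: "w \<subseteq> carrier (sep_algebra G)"
    by (auto simp: w_def sep_class_carrier)
  have "ba_filter (sep_algebra G) w"
    unfolding ba_filter_def
  proof (intro conjI ballI impI)
    show "w \<noteq> {}" using sub uf by (auto simp: ba_filter_def)
    show "y \<in> w" if xy: "x \<in> w" "y \<in> carrier (sep_algebra G)" "x \<sqsubseteq>\<^bsub>sep_algebra G\<^esub> y" for x y
    proof -
      obtain X Y where X: "X \<in> sep_sets G" "x = sep_class G X"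
        and Y: "Y \<in> sep_sets G" "y = sep_class G Y"
        using xy carr by (meson sep_carrierE subsetD)
      then have "finite (X - Y)" using xy(3) sep_le_iff by blast
      then show ?thesis using xy(1) X Y w_iff finite_Diff_trans by blast
    qed
    show "x \<sqinter>\<^bsub>sep_algebra G\<^esub> y \<in> w" if xy: "x \<in> w" "y \<in> w" for x y
    proof -
      obtain X Y where X: "X \<in> sep_sets G" "x = sep_class G X"
        and Y: "Y \<in> sep_sets G" "y = sep_class G Y"
        using xy carr by (meson sep_carrierE subsetD)
      obtain D E where D: "D \<in> sep_sets G" "sep_class G D \<in> u" "finite (A \<inter> D - X)"
        and E: "E \<in> sep_sets G" "sep_class G E \<in> u" "finite (A \<inter> E - Y)"
        using xy X Y w_iff by blast
      have "finite (A \<inter> (D \<inter> E) - X \<inter> Y)"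
        by (rule finite_subset[of _ "(A \<inter> D - X) \<union> (A \<inter> E - Y)"]) (use D E in auto)
      then have "sep_class G (X \<inter> Y) \<in> w"
        using w_iff[of "X \<inter> Y"] X Y D E Ult_sep_Int[OF u] sep_sets_Int by blast
      then show ?thesis using sep_meet X Y by metis
    qed
    show "\<bottom>\<^bsub>sep_algebra G\<^esub> \<notin> w"
    proof
      assume "\<bottom>\<^bsub>sep_algebra G\<^esub> \<in> w"
      then obtain D where D: "D \<in> sep_sets G" "sep_class G D \<in> u" "finite (A \<inter> D)"
        using w_iff[OF sep_sets_empty] by (auto simp: sep_bottom)
      \<comment> \<open>Properness of \<open>w\<close>: a finite \<open>A \<inter> D\<close> puts
        \<open>D\<close> almost inside the complement of \<open>A\<close>, which then lies in
        \<open>u\<close>.\<close>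
      have "D - (edges G - A) = A \<inter> D" using D(1) by (auto simp: sep_sets_def)
      then have "sep_class G (edges G - A) \<in> u"
        using Ult_sep_upward[OF u D(2) D(1) sep_sets_Compl[OF A]] D(3) by simp
      then show False using * by blast
    qed
  qed (use carr in auto)
  then have "w = u" using sub u by (auto simp: Ult_def)
  moreover obtain D where D: "D \<in> sep_sets G" "sep_class G D \<in> u"
    using uf sep_carrierE unfolding ba_filter_def by (metis equals0I subsetD)
  have "A \<inter> D - A = {}" by blast
  then have "sep_class G A \<in> w" using w_iff[OF A] D by (metis finite.emptyI)
  ultimately show False using * by blast
qed

text \<open>Builds an ultrafilter from edge sets rather than classes. By \<open>up\<close>,
  \<open>U\<close> is a union of classes, so membership can be read off representatives. Maximality
  comes from \<open>prime\<close>: a larger filter would contain some \<open>A\<close> outside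
  \<open>U\<close> along with its complement, hence the bottom element.\<close>

lemma Ult_sepI:
  assumes U: "U \<subseteq> sep_sets G"
    and up: "\<And>A B. A \<in> U \<Longrightarrow> B \<in> sep_sets G \<Longrightarrow> finite (A - B) \<Longrightarrow> B \<in> U"
    and int: "\<And>A B. A \<in> U \<Longrightarrow> B \<in> U \<Longrightarrow> A \<inter> B \<in> U"
    and fin: "\<And>A. A \<in> U \<Longrightarrow> infinite A"
    and prime: "\<And>A. A \<in> sep_sets G \<Longrightarrow> A \<in> U \<or> edges G - A \<in> U"
  shows "sep_class G ` U \<in> Ult (sep_algebra G)"
    and "A \<in> sep_sets G \<Longrightarrow> sep_class G A \<in> sep_class G ` U \<longleftrightarrow> A \<in> U"
proof -
  show mem: "sep_class G A \<in> sep_class G ` U \<longleftrightarrow> A \<in> U" if "A \<in> sep_sets G" for A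
  proof
    assume "sep_class G A \<in> sep_class G ` U"
    then obtain B where B: "B \<in> U" "sep_class G A = sep_class G B" by (rule imageE)
    then have "finite (B - A)" using that U sep_class_eq_iff by blast
    then show "A \<in> U" by (rule up[OF B(1) that])
  qed (rule imageI)
  have carr: "sep_class G ` U \<subseteq> carrier (sep_algebra G)"
    using U sep_class_carrier by blast
  have filt: "ba_filter (sep_algebra G) (sep_class G ` U)"
    unfolding ba_filter_def
  proof (intro conjI ballI impI)
    show "sep_class G ` U \<noteq> {}" using prime sep_sets_empty by blast
    show "y \<in> sep_class G ` U" if x: "x \<in> sep_class G ` U" and y: "y \<in> carrier (sep_algebra G)"
      and le: "x \<sqsubseteq>\<^bsub>sep_algebra G\<^esub> y" for x y
    proof -
      obtain A where A: "A \<in> U" "x = sep_class G A" using x by (rule imageE)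
      obtain B where B: "B \<in> sep_sets G" "y = sep_class G B" using y by (rule sep_carrierE)
      have "finite (A - B)" using le A B U sep_le_iff by blast
      then show ?thesis using up[OF A(1) B(1)] B(2) by blast
    qed
    show "x \<sqinter>\<^bsub>sep_algebra G\<^esub> y \<in> sep_class G ` U"
      if x: "x \<in> sep_class G ` U" and y: "y \<in> sep_class G ` U" for x y
    proof -
      obtain A where A: "A \<in> U" "x = sep_class G A" using x by (rule imageE)
      obtain B where B: "B \<in> U" "y = sep_class G B" using y by (rule imageE)
      have "x \<sqinter>\<^bsub>sep_algebra G\<^esub> y = sep_class G (A \<inter> B)"
        unfolding A(2) B(2) using A(1) B(1) U by (intro sep_meet) auto
      then show ?thesis using int[OF A(1) B(1)] by blast
    qed
    show "\<bottom>\<^bsub>sep_algebra G\<^esub> \<notin> sep_class G ` U"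
      using mem[OF sep_sets_empty] fin[of "{}"] by (auto simp: sep_bottom)
  qed (use carr in auto)
  moreover have "w = sep_class G ` U"
    if w: "ba_filter (sep_algebra G) w" "sep_class G ` U \<subseteq> w" for w
  proof (rule ccontr)
    assume "w \<noteq> sep_class G ` U"
    then obtain x where x: "x \<in> w" "x \<notin> sep_class G ` U" using w by blast
    then obtain A where A: "A \<in> sep_sets G" "x = sep_class G A"
      using w(1) by (meson ba_filter_def sep_carrierE subsetD)
    then have "sep_class G (edges G - A) \<in> w" using x prime w(2) by blast
    then have "sep_class G A \<sqinter>\<^bsub>sep_algebra G\<^esub> sep_class G (edges G - A) \<in> w"
      using w(1) x(1) A(2) by (simp add: ba_filter_def)
    then have "sep_class G (A \<inter> (edges G - A)) \<in> w"
      by (simp only: sep_meet[OF A(1) sep_sets_Compl[OF A(1)]])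
    moreover have "A \<inter> (edges G - A) = {}" by blast
    ultimately show False using w(1) by (simp add: ba_filter_def sep_bottom)
  qed
  ultimately show "sep_class G ` U \<in> Ult (sep_algebra G)" by (auto simp: Ult_def)
qed

text \<open>An ultrafilter would contain the class of \<open>{}\<close> or of
  \<open>edges G\<close>, but all its representatives are infinite.\<close>

lemma Ult_sep_empty:
  assumes "finite (edges G)"
  shows "Ult (sep_algebra G) = {}"
proof (rule equals0I)
  fix u assume u: "u \<in> Ult (sep_algebra G)"
  then have "sep_class G {} \<in> u \<or> sep_class G (edges G) \<in> u"
    using Ult_sep_prime[OF u sep_sets_empty] by simp
  then show False
    using Ult_sep_infinite[OF u _ sep_sets_empty] Ult_sep_infinite[OF u _ sep_sets_edges] assms
    by blast
qed


section \<open>Finite-order separations and components\<close>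

definition fin_sep :: "'v graph \<Rightarrow> 'v set \<Rightarrow> 'v set \<Rightarrow> bool" where
  "fin_sep G A B \<longleftrightarrow> is_separation G A B \<and> finite (A \<inter> B)"

definition span_edges :: "'v graph \<Rightarrow> 'v set \<Rightarrow> 'v set set" where
  "span_edges G A = {e \<in> edges G. e \<subseteq> A}"

lemma is_separation_iff:
  "is_separation G A B \<longleftrightarrow> A \<subseteq> verts G \<and> B \<subseteq> verts G \<and> A \<union> B = verts G \<and>
     (\<forall>e\<in>edges G. e \<subseteq> A \<or> e \<subseteq> B)"
  by (auto simp: is_separation_def induced_def)

lemma fin_sep_commute: "fin_sep G A B \<longleftrightarrow> fin_sep G B A"
  by (auto simp: fin_sep_def is_separation_iff Int_commute)

lemma fin_sep_orient:
  "fin_orientation G \<tau> \<Longrightarrow> fin_sep G A B \<Longrightarrow> (A, B) \<in> \<tau> \<or> (B, A) \<in> \<tau>"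
  unfolding fin_orientation_def fin_sep_def by blast

lemma fin_orientation_sep: "fin_orientation G \<tau> \<Longrightarrow> (A, B) \<in> \<tau> \<Longrightarrow> fin_sep G A B"
  unfolding fin_orientation_def fin_sep_def by blast

lemma equiv_reach: "equiv (verts G) (reach G)"
proof (rule equivI)
  have "sym {(u, v). {u, v} \<in> edges G}" by (auto simp: sym_def insert_commute)
  then show "sym (reach G)"
    unfolding reach_def by (intro sym_Int sym_rtrancl) (auto simp: sym_def)
  show "trans (reach G)"
    unfolding reach_def by (intro trans_Int trans_rtrancl) (auto simp: trans_def)
qed (auto simp: reach_def refl_on_def)

lemma Union_comps_minus: "\<Union>(comps_minus G F) = verts G - F"
  using Union_quotient[OF equiv_reach[of "induced G (verts G - F)"]]
  by (auto simp: comps_minus_def components_verts_def induced_def)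

lemma comps_minus_disjoint:
  "C \<in> comps_minus G F \<Longrightarrow> D \<in> comps_minus G F \<Longrightarrow> C = D \<or> C \<inter> D = {}"
  unfolding comps_minus_def components_verts_def by (rule quotient_disj[OF equiv_reach])

lemma comps_minus_edge:
  assumes C: "C \<in> comps_minus G F" and xy: "x \<in> C" "{x, y} \<in> edges G" "y \<in> verts G - F"
  shows "y \<in> C"
proof -
  let ?H = "induced G (verts G - F)"
  have x: "x \<in> verts G - F" using C xy(1) Union_comps_minus[of G F] by blast
  then have "(x, y) \<in> reach ?H"
    unfolding reach_def using xy(2,3) by (auto simp: induced_def intro!: r_into_rtrancl)
  moreover have "C \<in> verts ?H // reach ?H"
    using C by (simp add: comps_minus_def components_verts_def)
  ultimately show ?thesis using in_quotient_imp_closed[OF equiv_reach] xy(1) by metis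
qed

text \<open>No edge joins \<open>A - B\<close> to \<open>B - A\<close>, so a path that avoids
  \<open>A \<inter> B\<close> and starts in \<open>B\<close> never leaves \<open>B\<close>.\<close>

lemma component_one_side:
  assumes sep: "is_separation G A B" and C: "C \<in> comps_minus G (A \<inter> B)"
    and x: "x \<in> C" "x \<in> B"
  shows "C \<subseteq> B"
proof
  let ?H = "induced G (verts G - A \<inter> B)"
  fix y assume y: "y \<in> C"
  have "C \<in> verts ?H // reach ?H"
    using C by (simp add: comps_minus_def components_verts_def)
  then have "(x, y) \<in> reach ?H"
    using x(1) y by (intro in_quotient_imp_in_rel[OF equiv_reach]) auto
  then have "(x, y) \<in> {(u, v). {u, v} \<in> edges ?H}\<^sup>*" by (auto simp: reach_def)
  then show "y \<in> B"
    by (induction rule: rtrancl_induct) (use x sep in \<open>auto simp: induced_def is_separation_iff\<close>)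
qed

text \<open>An edge contained in neither side would join a component in \<open>\<A>\<close> to one
  outside \<open>\<A>\<close>.\<close>

lemma fin_sep_components:
  assumes "simple_graph G" "finite F" "F \<subseteq> verts G" "\<A> \<subseteq> comps_minus G F"
  shows "fin_sep G (F \<union> \<Union>(comps_minus G F - \<A>)) (F \<union> \<Union>\<A>)"
proof -
  let ?A = "F \<union> \<Union>(comps_minus G F - \<A>)" and ?B = "F \<union> \<Union>\<A>"
  have "?A \<union> ?B = F \<union> \<Union>(comps_minus G F)" using assms(4) by blast
  then have un: "?A \<union> ?B = verts G" using assms(3) by (auto simp: Union_comps_minus)
  have "\<Union>(comps_minus G F - \<A>) \<inter> \<Union>\<A> = {}"
    using comps_minus_disjoint assms(4) by fastforce
  then have int: "?A \<inter> ?B = F" by blast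
  have "e \<subseteq> ?A \<or> e \<subseteq> ?B" if e: "e \<in> edges G" for e
  proof (rule ccontr)
    assume *: "\<not> ?thesis"
    have e': "e \<subseteq> verts G" "card e = 2" using e assms(1) by (auto simp: simple_graph_def)
    obtain x y where xy: "x \<in> e" "y \<in> e" "x \<notin> ?A" "y \<notin> ?B" using * by blast
    then have B: "x \<in> ?B" and A: "y \<in> ?A" using un e' by blast+
    have "e = {x, y}"
    proof -
      have "finite e" using e'(2) by (simp add: card_ge_0_finite)
      moreover have "x \<noteq> y" using xy B by auto
      ultimately show ?thesis using e'(2) xy card_subset_eq[of e "{x, y}"] by auto
    qed
    moreover obtain C where C: "C \<in> \<A>" "x \<in> C" using B xy by blast
    ultimately have "y \<in> C"
      using comps_minus_edge[of C G F x y] assms(4) e e' xy by auto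
    then show False using C xy by blast
  qed
  then show ?thesis using un int assms(2) by (auto simp: fin_sep_def is_separation_iff)
qed

text \<open>Take \<open>F = A \<inter> B\<close> and let \<open>\<A>\<close> consist of the
  components inside \<open>B\<close>. By \<open>component_one_side\<close> every other component
  avoids \<open>B\<close> and hence lies in \<open>A\<close>.\<close>

lemma fin_sep_as_components:
  assumes "fin_sep G A B"
  obtains F \<A> where "finite F" "F \<subseteq> verts G" "\<A> \<subseteq> comps_minus G F"
    "A = F \<union> \<Union>(comps_minus G F - \<A>)" "B = F \<union> \<Union>\<A>"
proof
  let ?F = "A \<inter> B"
  let ?A = "{C \<in> comps_minus G ?F. C \<subseteq> B}"
  have sep: "is_separation G A B" and AB: "A \<subseteq> verts G" "B \<subseteq> verts G" "A \<union> B = verts G"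
    using assms by (auto simp: fin_sep_def is_separation_iff)
  note side = component_one_side[OF sep]
  have cov: "\<exists>C\<in>comps_minus G ?F. x \<in> C" if "x \<in> verts G" "x \<notin> ?F" for x
    using that Union_comps_minus[of G ?F] by blast
  have sub: "C \<subseteq> verts G - ?F" if "C \<in> comps_minus G ?F" for C
    using that Union_comps_minus[of G ?F] by blast
  show "B = ?F \<union> \<Union>?A"
  proof (intro equalityI subsetI)
    fix x assume x: "x \<in> B"
    show "x \<in> ?F \<union> \<Union>?A"
    proof (cases "x \<in> ?F")
      case False
      then obtain C where C: "C \<in> comps_minus G ?F" "x \<in> C" using cov[of x] x AB by blast
      then have "C \<in> ?A" using side[OF C x] by simp
      then show ?thesis using C(2) by (intro UnI2 UnionI)
    qed (rule UnI1)
  qed auto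
  show "A = ?F \<union> \<Union>(comps_minus G ?F - ?A)"
  proof (intro equalityI subsetI)
    fix x assume x: "x \<in> A"
    show "x \<in> ?F \<union> \<Union>(comps_minus G ?F - ?A)"
    proof (cases "x \<in> ?F")
      case False
      then obtain C where C: "C \<in> comps_minus G ?F" "x \<in> C" using cov[of x] x AB by blast
      then have "C \<in> comps_minus G ?F - ?A" using x False by auto
      then show ?thesis using C(2) by (intro UnI2 UnionI)
    qed (rule UnI1)
  next
    fix x assume "x \<in> ?F \<union> \<Union>(comps_minus G ?F - ?A)"
    then consider "x \<in> ?F" | C where "C \<in> comps_minus G ?F" "\<not> C \<subseteq> B" "x \<in> C" by auto
    then show "x \<in> A"
    proof cases
      case 2
      then have "x \<notin> B" "x \<in> verts G" using side[OF 2(1) 2(3)] sub[OF 2(1)] by auto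
      then show ?thesis using AB by blast
    qed blast
  qed
qed (use assms in \<open>auto simp: fin_sep_def is_separation_iff\<close>)

text \<open>The two generating families are equal, so the continuity proofs need not mention
  components.\<close>

lemma tangle_topology_fin_sep:
  assumes "simple_graph G"
  shows "tangle_topology G =
    topology_generated_by {{\<tau> \<in> tangles G. (A, B) \<in> \<tau>} | A B. fin_sep G A B}"
proof -
  have "{{\<tau> \<in> tangles G. (F \<union> \<Union>(comps_minus G F - \<A>), F \<union> \<Union>\<A>) \<in> \<tau>} | F \<A>.
        finite F \<and> F \<subseteq> verts G \<and> \<A> \<subseteq> comps_minus G F} =
      {{\<tau> \<in> tangles G. (A, B) \<in> \<tau>} | A B. fin_sep G A B}" (is "?L = ?R")
  proof
    show "?L \<subseteq> ?R" using fin_sep_components[OF assms] by blast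
    show "?R \<subseteq> ?L"
    proof clarify
      fix A B assume "fin_sep G A B"
      then obtain F \<A> where "finite F" "F \<subseteq> verts G" "\<A> \<subseteq> comps_minus G F"
        and "A = F \<union> \<Union>(comps_minus G F - \<A>)" "B = F \<union> \<Union>\<A>"
        by (rule fin_sep_as_components)
      then show "\<exists>F \<A>. {\<tau> \<in> tangles G. (A, B) \<in> \<tau>} =
          {\<tau> \<in> tangles G. (F \<union> \<Union>(comps_minus G F - \<A>), F \<union> \<Union>\<A>) \<in> \<tau>} \<and>
          finite F \<and> F \<subseteq> verts G \<and> \<A> \<subseteq> comps_minus G F"
        by blast
    qed
  qed
  then show ?thesis by (simp only: tangle_topology_def)
qed

text \<open>For finite \<open>verts G\<close> the separation with both sides equal to
  \<open>verts G\<close> has finite order, and its only orientation is a contradiction of order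
  1.\<close>

lemma tangles_empty:
  assumes "simple_graph G" "finite (verts G)"
  shows "tangles G = {}"
proof (rule equals0I)
  fix \<tau> assume \<tau>: "\<tau> \<in> tangles G"
  have "fin_sep G (verts G) (verts G)"
    using assms by (auto simp: fin_sep_def is_separation_iff simple_graph_def)
  then have "(verts G, verts G) \<in> \<tau>" using \<tau> fin_sep_orient by (auto simp: tangles_def)
  moreover have "contradiction G [(verts G, verts G)]"
    using assms by (auto simp: contradiction_def graph_Union_def induced_def simple_graph_def
        intro!: graph.equality)
  ultimately show False using \<tau> by (force simp: tangles_def)
qed


section \<open>The correspondence for graphs without isolated vertices\<close>

text \<open>By \<open>cover\<close>, every vertex is seen by an edge, so covering \<open>G\<close>
  by induced subgraphs means covering its edges, and a bipartition of the edges yields a separation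
  of \<open>G\<close>.\<close>

locale no_isolated =
  fixes G :: "'v graph"
  assumes simple: "simple_graph G" and cover: "\<Union>(edges G) = verts G"
begin

section \<open>Translation between separations of finite order and edge sets\<close>

lemma finite_span_edges: "finite X \<Longrightarrow> finite (span_edges G X)"
  by (rule finite_subset[of _ "Pow X"]) (auto simp: span_edges_def)

text \<open>Edges not inside \<open>A\<close> lie inside \<open>B\<close>, so the boundary of
  \<open>span_edges G A\<close> is contained in \<open>A \<inter> B\<close>.\<close>

lemma span_edges_sep_sets:
  assumes "fin_sep G A B"
  shows "span_edges G A \<in> sep_sets G"
proof -
  have "\<Union>(span_edges G A) \<inter> \<Union>(edges G - span_edges G A) \<subseteq> A \<inter> B"
    using assms by (auto simp: span_edges_def fin_sep_def is_separation_iff)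
  then have "finite (\<Union>(span_edges G A) \<inter> \<Union>(edges G - span_edges G A))"
    by (rule finite_subset) (use assms in \<open>simp add: fin_sep_def\<close>)
  then show ?thesis by (auto simp: sep_sets_def span_edges_def)
qed

lemma span_edges_Un: "fin_sep G A B \<Longrightarrow> span_edges G A \<union> span_edges G B = edges G"
  by (auto simp: span_edges_def fin_sep_def is_separation_iff)

lemma finite_span_edges_Int: "fin_sep G A B \<Longrightarrow> finite (span_edges G A \<inter> span_edges G B)"
  by (rule rev_finite_subset[OF finite_span_edges[of "A \<inter> B"]])
    (auto simp: span_edges_def fin_sep_def)

lemma fin_sep_of_edges:
  assumes "E \<in> sep_sets G"
  shows "fin_sep G (\<Union>E) (\<Union>(edges G - E))"
proof -
  have "E \<subseteq> edges G" using assms by (simp add: sep_sets_def)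
  then have "\<Union>E \<union> \<Union>(edges G - E) = verts G" unfolding cover[symmetric] by blast
  then show ?thesis using assms by (auto simp: sep_sets_def fin_sep_def is_separation_iff)
qed

text \<open>The additional edges have both ends in the finite boundary of \<open>E\<close>. Hence
  going from \<open>E\<close> to its vertex set and back does not change the class.\<close>

lemma finite_span_edges_Diff:
  assumes "E \<in> sep_sets G"
  shows "finite (span_edges G (\<Union>E) - E)"
  using finite_span_edges_Int[OF fin_sep_of_edges[OF assms]]
  by (rule rev_finite_subset) (auto simp: span_edges_def)

lemma contradiction_iff:
  assumes "ss \<noteq> []"
  shows "contradiction G ss \<longleftrightarrow> (\<forall>e\<in>edges G. \<exists>s\<in>set ss. e \<subseteq> fst s)"
proof
  assume c: "contradiction G ss"
  show "\<forall>e\<in>edges G. \<exists>s\<in>set ss. e \<subseteq> fst s"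
  proof
    fix e assume "e \<in> edges G"
    then have "e \<in> edges (graph_Union ((\<lambda>(A, B). induced G A) ` set ss))"
      using c by (simp add: contradiction_def)
    then show "\<exists>s\<in>set ss. e \<subseteq> fst s"
      by (auto simp: graph_Union_def induced_def split_beta)
  qed
next
  assume *: "\<forall>e\<in>edges G. \<exists>s\<in>set ss. e \<subseteq> fst s"
  have "\<exists>s\<in>set ss. v \<in> fst s" if v: "v \<in> verts G" for v
  proof -
    obtain e where "e \<in> edges G" "v \<in> e" using v cover by blast
    then show ?thesis using * by blast
  qed
  then show "contradiction G ss"
    unfolding contradiction_def using *
    by (intro graph.equality) (auto simp: graph_Union_def induced_def split_beta)
qed

text \<open>The form in which the tangle axiom is used below. The three pairs may coincide, which
  includes contradictions of order 1 and 2.\<close>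

lemma tangle_no_cover:
  assumes \<tau>: "\<tau> \<in> tangles G" and "(A1, B1) \<in> \<tau>" "(A2, B2) \<in> \<tau>" "(A3, B3) \<in> \<tau>"
  shows "\<not> edges G \<subseteq> span_edges G A1 \<union> span_edges G A2 \<union> span_edges G A3"
proof
  assume *: "edges G \<subseteq> span_edges G A1 \<union> span_edges G A2 \<union> span_edges G A3"
  have "contradiction G [(A1, B1), (A2, B2), (A3, B3)]"
    using * by (auto simp: contradiction_iff span_edges_def)
  moreover have "length [(A1, B1), (A2, B2), (A3, B3)] \<in> {1, 2, 3}"
    "set [(A1, B1), (A2, B2), (A3, B3)] \<subseteq> \<tau>" using assms by auto
  ultimately show False using \<tau> unfolding tangles_def by blast
qed

text \<open>The opposite orientation has \<open>verts G\<close> as its first side and is a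
  contradiction by itself.\<close>

lemma tangle_finite_side:
  assumes \<tau>: "\<tau> \<in> tangles G" and X: "finite X" "X \<subseteq> verts G"
  shows "(X, verts G) \<in> \<tau>"
proof (rule ccontr)
  assume *: "(X, verts G) \<notin> \<tau>"
  have "fin_sep G X (verts G)"
    using X simple by (auto simp: fin_sep_def is_separation_iff simple_graph_def)
  then have "(verts G, X) \<in> \<tau>" using * \<tau> fin_sep_orient by (auto simp: tangles_def)
  moreover have "edges G \<subseteq> span_edges G (verts G)"
    using simple by (auto simp: span_edges_def simple_graph_def)
  ultimately show False using tangle_no_cover[OF \<tau>] by blast
qed

text \<open>If only finitely many edges were missed, their ends would form a finite set, and
  \<open>tangle_finite_side\<close> would supply it as the third side of a cover.\<close>

lemma tangle_no_cofinite_cover: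
  assumes \<tau>: "\<tau> \<in> tangles G" and AB: "(A1, B1) \<in> \<tau>" "(A2, B2) \<in> \<tau>"
  shows "infinite (edges G - (span_edges G A1 \<union> span_edges G A2))" (is "infinite ?D")
proof
  assume "finite ?D"
  moreover have "finite e" if "e \<in> edges G" for e
    using simple that by (intro card_ge_0_finite) (auto simp: simple_graph_def)
  ultimately have "finite (\<Union>?D)" by auto
  then have "(\<Union>?D, verts G) \<in> \<tau>" using tangle_finite_side[OF \<tau>] cover by auto
  moreover have "edges G \<subseteq> span_edges G A1 \<union> span_edges G A2 \<union> span_edges G (\<Union>?D)"
    by (auto simp: span_edges_def)
  ultimately show False using tangle_no_cover[OF \<tau> AB] by blast
qed

section \<open>The maps between ultrafilters and tangles\<close>

definition tangle_of :: "'v set set set set \<Rightarrow> ('v set \<times> 'v set) set" where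
  "tangle_of u = {(A, B). fin_sep G A B \<and> sep_class G (span_edges G B) \<in> u}"

text \<open>An oriented separation in a tangle has its small side first. The ultrafilter is
  described on edge sets here; \<open>ult_of\<close> passes to classes.\<close>

definition large :: "('v set \<times> 'v set) set \<Rightarrow> 'v set set set" where
  "large \<tau> = {E \<in> sep_sets G. (\<Union>(edges G - E), \<Union>E) \<in> \<tau>}"

definition ult_of :: "('v set \<times> 'v set) set \<Rightarrow> 'v set set set set" where
  "ult_of \<tau> = sep_class G ` large \<tau>"

lemma tangle_of_tangle:
  assumes u: "u \<in> Ult (sep_algebra G)"
  shows "tangle_of u \<in> tangles G"
proof -
  \<comment> \<open>The edge sets of the two sides cover \<open>edges G\<close> and share only
    finitely many edges, so they are complementary modulo finite sets.\<close>
  have ex: "sep_class G (span_edges G A) \<in> u \<longleftrightarrow> sep_class G (span_edges G B) \<notin> u"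
    if s: "fin_sep G A B" for A B
  proof
    note sets = span_edges_sep_sets[OF s] span_edges_sep_sets[OF iffD1[OF fin_sep_commute s]]
    show "sep_class G (span_edges G B) \<notin> u" if "sep_class G (span_edges G A) \<in> u"
      using Ult_sep_infinite[OF u Ult_sep_Int[OF u that _ sets] sep_sets_Int[OF sets]]
        finite_span_edges_Int[OF s] by blast
    show "sep_class G (span_edges G A) \<in> u" if "sep_class G (span_edges G B) \<notin> u"
    proof -
      have "edges G - span_edges G B - span_edges G A = {}" using span_edges_Un[OF s] by blast
      then show ?thesis
        using that Ult_sep_prime[OF u sets(2)] Ult_sep_upward[OF u _ sep_sets_Compl[OF sets(2)] sets(1)]
        by (metis finite.emptyI)
    qed
  qed
  have "\<exists>!s. s \<in> tangle_of u \<and> s \<in> {(A, B), (B, A)}" if s: "fin_sep G A B" for A B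
    using ex[OF s] s fin_sep_commute[of G A B] unfolding tangle_of_def by blast
  then have "fin_orientation G (tangle_of u)"
    unfolding fin_orientation_def by (auto simp: tangle_of_def fin_sep_def)
  moreover have "\<not> contradiction G ss"
    if "length ss \<in> {1, 2, 3}" and sub: "set ss \<subseteq> tangle_of u" for ss
  proof
    assume "contradiction G ss"
    moreover have "ss \<noteq> []" using that(1) by auto
    ultimately have cov: "\<forall>e\<in>edges G. \<exists>s\<in>set ss. e \<subseteq> fst s"
      using contradiction_iff by blast
    \<comment> \<open>The witness is the intersection of the complements of all small sides, built
      along the list from \<open>edges G\<close>. A contradiction would make it empty, but members
      of \<open>u\<close> have infinite representatives.\<close>
    have "\<exists>E\<in>sep_sets G. sep_class G E \<in> u \<and> (\<forall>e\<in>E. \<forall>s\<in>set ss. \<not> e \<subseteq> fst s)"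
      using sub
    proof (induction ss)
      case Nil
      show ?case
        using Ult_sep_prime[OF u sep_sets_empty] Ult_sep_infinite[OF u _ sep_sets_empty]
          sep_sets_edges by auto
    next
      case (Cons s ss)
      obtain A B where s: "s = (A, B)" by fastforce
      then have AB: "fin_sep G A B" "sep_class G (span_edges G B) \<in> u"
        using Cons.prems by (auto simp: tangle_of_def)
      note sets = span_edges_sep_sets[OF AB(1)]
      have "sep_class G (edges G - span_edges G A) \<in> u"
        using Ult_sep_prime[OF u sets] ex[OF AB(1)] AB(2) by blast
      moreover obtain E where E: "E \<in> sep_sets G" "sep_class G E \<in> u"
        "\<forall>e\<in>E. \<forall>s\<in>set ss. \<not> e \<subseteq> fst s"
        using Cons by auto
      ultimately have "sep_class G (E \<inter> (edges G - span_edges G A)) \<in> u"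
        using Ult_sep_Int[OF u] sep_sets_Compl[OF sets] by blast
      moreover have "E \<inter> (edges G - span_edges G A) \<in> sep_sets G"
        using E sets by (simp add: sep_sets_Int sep_sets_Compl)
      moreover have "\<forall>e\<in>E \<inter> (edges G - span_edges G A). \<forall>s\<in>set (s # ss). \<not> e \<subseteq> fst s"
        using E(3) by (auto simp: s span_edges_def)
      ultimately show ?case by blast
    qed
    then obtain E where E: "E \<in> sep_sets G" "sep_class G E \<in> u"
      "\<forall>e\<in>E. \<forall>s\<in>set ss. \<not> e \<subseteq> fst s" by blast
    then have "E = {}" using cov by (fastforce simp: sep_sets_def)
    then show False using Ult_sep_infinite[OF u E(2) E(1)] by simp
  qed
  ultimately show ?thesis by (auto simp: tangles_def)
qed

text \<open>One orientation is present because a tangle orients the separation induced by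
  \<open>E\<close>; both cannot be, since their first sides cover all edges.\<close>

lemma not_large_iff:
  assumes \<tau>: "\<tau> \<in> tangles G" and E: "E \<in> sep_sets G"
  shows "E \<notin> large \<tau> \<longleftrightarrow> (\<Union>E, \<Union>(edges G - E)) \<in> \<tau>"
proof
  show "(\<Union>E, \<Union>(edges G - E)) \<in> \<tau>" if "E \<notin> large \<tau>"
    using that E \<tau> fin_sep_orient[OF _ fin_sep_of_edges[OF E]] by (auto simp: large_def tangles_def)
  show "E \<notin> large \<tau>" if *: "(\<Union>E, \<Union>(edges G - E)) \<in> \<tau>"
  proof
    assume "E \<in> large \<tau>"
    then have **: "(\<Union>(edges G - E), \<Union>E) \<in> \<tau>" by (simp add: large_def)
    have "edges G \<subseteq> span_edges G (\<Union>E) \<union> span_edges G (\<Union>(edges G - E)) \<union> span_edges G (\<Union>E)"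
      by (auto simp: span_edges_def)
    then show False using tangle_no_cover[OF \<tau> * ** *] by blast
  qed
qed

lemma large_Compl_iff:
  assumes "\<tau> \<in> tangles G" "E \<in> sep_sets G"
  shows "edges G - E \<in> large \<tau> \<longleftrightarrow> E \<notin> large \<tau>"
proof -
  have "edges G - (edges G - E) = E" using assms(2) by (auto simp: sep_sets_def)
  then show ?thesis
    using not_large_iff[OF assms] sep_sets_Compl[OF assms(2)] by (simp add: large_def)
qed

text \<open>An edge spanned by neither small side lies in \<open>E \<inter> F\<close>, so a finite
  intersection would give a cofinite cover by two small sides.\<close>

lemma large_meet_infinite:
  assumes \<tau>: "\<tau> \<in> tangles G" and EF: "E \<in> large \<tau>" "F \<in> large \<tau>"
  shows "infinite (E \<inter> F)"
proof
  assume "finite (E \<inter> F)"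
  moreover have "edges G - (span_edges G (\<Union>(edges G - E)) \<union> span_edges G (\<Union>(edges G - F)))
      \<subseteq> E \<inter> F" by (auto simp: span_edges_def)
  ultimately show False
    using tangle_no_cofinite_cover[OF \<tau>] EF finite_subset unfolding large_def by blast
qed

text \<open>Otherwise the complement of \<open>F\<close> is large and meets \<open>E\<close> in
  \<open>E - F\<close>, which would have to be infinite.\<close>

lemma large_upward:
  assumes \<tau>: "\<tau> \<in> tangles G" and E: "E \<in> large \<tau>" and F: "F \<in> sep_sets G" "finite (E - F)"
  shows "F \<in> large \<tau>"
proof (rule ccontr)
  assume "F \<notin> large \<tau>"
  then have "infinite (E \<inter> (edges G - F))"
    using large_meet_infinite[OF \<tau> E] large_Compl_iff[OF \<tau> F(1)] by blast
  moreover have "E \<inter> (edges G - F) \<subseteq> E - F" by blast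
  ultimately show False using F(2) finite_subset by blast
qed

text \<open>Otherwise \<open>E \<inter> F\<close> and the complements of \<open>E\<close> and
  \<open>F\<close> are all small, yet together they contain every edge: a contradiction of order
  3.\<close>

lemma large_Int:
  assumes \<tau>: "\<tau> \<in> tangles G" and EF: "E \<in> large \<tau>" "F \<in> large \<tau>"
  shows "E \<inter> F \<in> large \<tau>"
proof (rule ccontr)
  assume "E \<inter> F \<notin> large \<tau>"
  moreover have "E \<inter> F \<in> sep_sets G" using EF by (auto simp: large_def sep_sets_Int)
  ultimately have "(\<Union>(E \<inter> F), \<Union>(edges G - E \<inter> F)) \<in> \<tau>" using not_large_iff[OF \<tau>] by blast
  moreover have "(\<Union>(edges G - E), \<Union>E) \<in> \<tau>" "(\<Union>(edges G - F), \<Union>F) \<in> \<tau>"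
    using EF by (auto simp: large_def)
  moreover have "edges G \<subseteq> span_edges G (\<Union>(E \<inter> F)) \<union> span_edges G (\<Union>(edges G - E))
      \<union> span_edges G (\<Union>(edges G - F))" by (auto simp: span_edges_def)
  ultimately show False using tangle_no_cover[OF \<tau>] by blast
qed

lemma
  assumes \<tau>: "\<tau> \<in> tangles G"
  shows ult_of_Ult: "ult_of \<tau> \<in> Ult (sep_algebra G)"
    and ult_of_iff: "E \<in> sep_sets G \<Longrightarrow> sep_class G E \<in> ult_of \<tau> \<longleftrightarrow> E \<in> large \<tau>"
proof -
  have inf: "infinite E" if "E \<in> large \<tau>" for E
    using large_meet_infinite[OF \<tau> that that] by simp
  have *: "large \<tau> \<subseteq> sep_sets G" by (auto simp: large_def)
  have prime: "E \<in> large \<tau> \<or> edges G - E \<in> large \<tau>" if "E \<in> sep_sets G" for E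
    using large_Compl_iff[OF \<tau> that] by blast
  show "ult_of \<tau> \<in> Ult (sep_algebra G)" unfolding ult_of_def
    by (rule Ult_sepI(1)[OF * large_upward[OF \<tau>] large_Int[OF \<tau>] inf prime])
  show "sep_class G E \<in> ult_of \<tau> \<longleftrightarrow> E \<in> large \<tau>" if "E \<in> sep_sets G" unfolding ult_of_def
    by (rule Ult_sepI(2)[OF * large_upward[OF \<tau>] large_Int[OF \<tau>] inf prime that])
qed

text \<open>\<open>large\<close> tests the separation induced by \<open>span_edges G B\<close>,
  which may differ from \<open>(A, B)\<close>. If \<open>\<tau>\<close> oriented the two
  inconsistently, their small sides would cover all edges. The converse applies this to
  \<open>(B, A)\<close>: two large edge sets cannot have a finite intersection.\<close>

lemma span_edges_large_iff:
  assumes \<tau>: "\<tau> \<in> tangles G" and s: "fin_sep G A B"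
  shows "span_edges G B \<in> large \<tau> \<longleftrightarrow> (A, B) \<in> \<tau>"
proof -
  have imp: "span_edges G B \<in> large \<tau>" if AB: "(A, B) \<in> \<tau>" "fin_sep G A B" for A B
  proof (rule ccontr)
    have sets: "span_edges G B \<in> sep_sets G"
      using AB(2) fin_sep_commute span_edges_sep_sets by blast
    assume "span_edges G B \<notin> large \<tau>"
    then have "(\<Union>(span_edges G B), \<Union>(edges G - span_edges G B)) \<in> \<tau>"
      using not_large_iff[OF \<tau> sets] by blast
    moreover have "span_edges G B \<subseteq> span_edges G (\<Union>(span_edges G B))"
      by (auto simp: span_edges_def)
    ultimately show False
      using tangle_no_cover[OF \<tau> AB(1) AB(1)] span_edges_Un[OF AB(2)] by blast
  qed
  show ?thesis
  proof
    assume large: "span_edges G B \<in> large \<tau>"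
    show "(A, B) \<in> \<tau>"
    proof (rule ccontr)
      assume "(A, B) \<notin> \<tau>"
      then have "(B, A) \<in> \<tau>" using fin_sep_orient[OF _ s] \<tau> by (auto simp: tangles_def)
      then have "span_edges G A \<in> large \<tau>" using imp s fin_sep_commute by blast
      then show False
        using large_meet_infinite[OF \<tau> _ large] finite_span_edges_Int[OF s] by blast
    qed
  qed (use imp s in blast)
qed

lemma ult_of_span_iff:
  assumes "\<tau> \<in> tangles G" "fin_sep G A B"
  shows "sep_class G (span_edges G B) \<in> ult_of \<tau> \<longleftrightarrow> (A, B) \<in> \<tau>"
  using assms ult_of_iff span_edges_large_iff span_edges_sep_sets fin_sep_commute by blast

lemma tangle_of_ult_of:
  assumes \<tau>: "\<tau> \<in> tangles G"
  shows "tangle_of (ult_of \<tau>) = \<tau>"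
  using ult_of_span_iff[OF \<tau>] fin_orientation_sep \<tau> by (fastforce simp: tangle_of_def tangles_def)

text \<open>\<open>tangle_of\<close> looks at \<open>span_edges G (\<Union>E)\<close>, which differs
  from \<open>E\<close> by finitely many edges only.\<close>

lemma large_tangle_of_iff:
  assumes u: "u \<in> Ult (sep_algebra G)" and E: "E \<in> sep_sets G"
  shows "E \<in> large (tangle_of u) \<longleftrightarrow> sep_class G E \<in> u"
proof -
  have s: "fin_sep G (\<Union>(edges G - E)) (\<Union>E)"
    using fin_sep_of_edges[OF E] fin_sep_commute by blast
  have "finite (E - span_edges G (\<Union>E))"
    by (rule finite_subset[of _ "{}"]) (use E in \<open>auto simp: span_edges_def sep_sets_def\<close>)
  then have "sep_class G (span_edges G (\<Union>E)) = sep_class G E"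
    using sep_class_eq_iff[OF span_edges_sep_sets[OF fin_sep_of_edges[OF E]] E]
      finite_span_edges_Diff[OF E] by blast
  then show ?thesis using s E by (simp add: large_def tangle_of_def)
qed

lemma ult_of_tangle_of:
  assumes u: "u \<in> Ult (sep_algebra G)"
  shows "ult_of (tangle_of u) = u"
proof -
  have carr: "x \<in> carrier (sep_algebra G)" if "x \<in> u" "u \<in> Ult (sep_algebra G)" for x u
    using that by (auto simp: Ult_def ba_filter_def)
  have "x \<in> ult_of (tangle_of u) \<longleftrightarrow> x \<in> u" if "x \<in> carrier (sep_algebra G)" for x
    using that ult_of_iff[OF tangle_of_tangle[OF u]] large_tangle_of_iff[OF u]
    by (elim sep_carrierE) blast
  then show ?thesis using carr u ult_of_Ult[OF tangle_of_tangle[OF u]] by blast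
qed

section \<open>Continuity in both directions\<close>

lemma continuous_tangle_of:
  "continuous_map (ult_topology (sep_algebra G)) (tangle_topology G) tangle_of"
  unfolding tangle_topology_fin_sep[OF simple]
proof (rule continuous_on_generated_topo)
  show "tangle_of ` topspace (ult_topology (sep_algebra G))
      \<subseteq> \<Union>{{\<tau> \<in> tangles G. (A, B) \<in> \<tau>} | A B. fin_sep G A B}"
    using tangle_of_tangle topspace_tangle_topology[OF simple]
    unfolding tangle_topology_fin_sep[OF simple] by auto
next
  fix U assume "U \<in> {{\<tau> \<in> tangles G. (A, B) \<in> \<tau>} | A B. fin_sep G A B}"
  then obtain A B where s: "fin_sep G A B" and U: "U = {\<tau> \<in> tangles G. (A, B) \<in> \<tau>}" by blast
  \<comment> \<open>The preimage of a generating set is a single basic open set, given by the edges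
    inside the second side.\<close>
  have "tangle_of -` U \<inter> topspace (ult_topology (sep_algebra G)) =
      {u \<in> Ult (sep_algebra G). sep_class G (span_edges G B) \<in> u}"
    using s tangle_of_tangle by (auto simp: U tangle_of_def)
  moreover have "sep_class G (span_edges G B) \<in> carrier (sep_algebra G)"
    using s fin_sep_commute span_edges_sep_sets sep_class_carrier by blast
  ultimately show "openin (ult_topology (sep_algebra G))
      (tangle_of -` U \<inter> topspace (ult_topology (sep_algebra G)))"
    unfolding ult_topology_def by (intro topology_generated_by_Basis) auto
qed

lemma continuous_ult_of:
  "continuous_map (tangle_topology G) (ult_topology (sep_algebra G)) ult_of"
  unfolding ult_topology_def
proof (rule continuous_on_generated_topo)
  show "ult_of ` topspace (tangle_topology G)
      \<subseteq> \<Union>{{u \<in> Ult (sep_algebra G). b \<in> u} | b. b \<in> carrier (sep_algebra G)}"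
    using ult_of_Ult topspace_ult_topology[of "sep_algebra G"]
    by (auto simp: ult_topology_def topspace_tangle_topology[OF simple])
next
  fix U assume "U \<in> {{u \<in> Ult (sep_algebra G). b \<in> u} | b. b \<in> carrier (sep_algebra G)}"
  then obtain E where E: "E \<in> sep_sets G" and U: "U = {u \<in> Ult (sep_algebra G). sep_class G E \<in> u}"
    by (auto elim: sep_carrierE)
  \<comment> \<open>Likewise, a basic open set pulls back to the generating set of the separation
    induced by \<open>E\<close>.\<close>
  have "ult_of -` U \<inter> topspace (tangle_topology G) =
      {\<tau> \<in> tangles G. (\<Union>(edges G - E), \<Union>E) \<in> \<tau>}"
    using E ult_of_Ult ult_of_iff
    by (auto simp: U topspace_tangle_topology[OF simple] large_def)
  moreover have "fin_sep G (\<Union>(edges G - E)) (\<Union>E)"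
    using fin_sep_of_edges[OF E] fin_sep_commute by blast
  then have "openin (tangle_topology G) {\<tau> \<in> tangles G. (\<Union>(edges G - E), \<Union>E) \<in> \<tau>}"
    unfolding tangle_topology_fin_sep[OF simple] by (intro topology_generated_by_Basis) blast
  ultimately show "openin (tangle_topology G) (ult_of -` U \<inter> topspace (tangle_topology G))"
    by (simp only:)
qed

lemma homeomorphic_maps_tangle_of:
  "homeomorphic_maps (ult_topology (sep_algebra G)) (tangle_topology G) tangle_of ult_of"
  using continuous_tangle_of continuous_ult_of tangle_of_ult_of ult_of_tangle_of
  by (simp add: homeomorphic_maps_def topspace_tangle_topology[OF simple])

end

section \<open>Isolated vertices and the general case\<close>

lemma isolated_vertex_singleton:
  assumes "connected_graph G" "v \<in> verts G" "v \<notin> \<Union>(edges G)"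
  shows "verts G = {v}"
proof -
  have "w = v" if "w \<in> verts G" for w
  proof -
    have "(v, w) \<in> {(u, v). {u, v} \<in> edges G}\<^sup>*"
      using assms(1,2) that by (auto simp: connected_graph_def reach_def)
    \<comment> \<open>A nontrivial walk from \<open>v\<close> would start with an edge at
      \<open>v\<close>.\<close>
    then show ?thesis using assms(3) by (cases rule: converse_rtranclE) auto
  qed
  then show ?thesis using assms(2) by blast
qed

theorem theorem8:
  fixes G :: "'v graph"
  assumes "simple_graph G" and "connected_graph G"
  shows "\<exists>h. homeomorphic_map (ult_topology (sep_algebra G)) (tangle_topology G) h"
proof (cases "\<Union>(edges G) = verts G")
  case True
  then interpret no_isolated G by unfold_locales (use assms in auto)
  show ?thesis using homeomorphic_maps_tangle_of homeomorphic_maps_map by blast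
next
  \<comment> \<open>Here \<open>G\<close> is a single vertex, and both spaces are empty.\<close>
  case False
  moreover have "\<Union>(edges G) \<subseteq> verts G" using assms(1) by (auto simp: simple_graph_def)
  ultimately obtain v where v: "v \<in> verts G" "v \<notin> \<Union>(edges G)" by blast
  then have fin: "finite (verts G)" using isolated_vertex_singleton[OF assms(2) v] by simp
  have "finite (edges G)"
    by (rule finite_subset[of _ "Pow (verts G)"])
      (use assms(1) fin in \<open>auto simp: simple_graph_def\<close>)
  then have "ult_topology (sep_algebra G) = trivial_topology" "tangle_topology G = trivial_topology"
    using Ult_sep_empty tangles_empty[OF assms(1) fin] topspace_tangle_topology[OF assms(1)]
    by (simp_all flip: null_topspace_iff_trivial)
  then have "ult_topology (sep_algebra G) homeomorphic_space tangle_topology G"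
    by (simp add: homeomorphic_empty_space_eq)
  then show ?thesis by (simp add: homeomorphic_space)
qed

end
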